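(* Let $\Upsilon$ be a set of positions. Then $\mathcal{M}_{\mathrm{cl}(\Upsilon)} \cong \mathcal{M}_{\mathrm{cl}( * )}$ (as misère monoids) if and only if all of the following hold: (1) $\Upsilon$ contains a position other than $0$; (2) for every $\xi \in \mathrm{cl}(\Upsilon)$, $o^-(\xi) \in \{\mathcal{N}, \mathcal{P}\}$; (3) for every $\xi \in \mathrm{cl}(\Upsilon)$ with $o^-(\xi) = \mathcal{N}$, every Left option $\xi^L$ of $\xi$ satisfies $o^-(\xi^L) = \mathcal{P}$ and every Right option $\xi^R$ of $\xi$ satisfies $o^-(\xi^R)=\mathcal{P}$.
   Context: A position $\xi=\{\xi^L \mid \xi^R\}$ is given recursively by finite sets of Left options and Right options (finite game tree); $\cdot$ denotes an empty option set. $0=\{\cdot\mid\cdot\}$, $*=\{0\mid 0\}$. The disjunctive sum is $\alpha+\beta=\{\alpha^L+\beta,\alpha+\beta^L \mid \alpha^R+\beta,\alpha+\beta^R\}$. Under misère play a player unable to move on their turn wins. The misère outcome $o^-(\xi)$ is $\mathcal{L}$ (Left wins moving first and second), $\mathcal{R}$ (Right wins moving first and second), $\mathcal{N}$ (the player to move next wins) or $\mathcal{P}$ (the player to move next loses). A set of positions is closed if it is closed under disjunctive sum and under taking options; $\mathrm{cl}(\Upsilon)$ is the smallest closed set containing $\Upsilon$. For a closed set $\Gamma$ and $\alpha,\beta\in\Gamma$, $\alpha\equiv\beta \pmod{\Gamma}$ means $o^-(\alpha+\gamma)=o^-(\beta+\gamma)$ for all $\gamma\in\Gamma$. The misère monoid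 $\mathcal{M}_{\Gamma}$ is the commutative monoid of $\equiv$-classes of $\Gamma$ with operation induced by disjunctive sum and identity the class of $0$, equipped with the outcome tetrapartition assigning each class the (common) misère outcome of its members. Two misère monoids are isomorphic if there is a monoid isomorphism between them which, together with its inverse, preserves the outcome of every element. $\mathcal{M}_{\mathrm{cl}( * )}$ has exactly two elements $1$ (class of $0$, outcome $\mathcal{N}$) and $a$ (class of $*$, outcome $\mathcal{P}$) with $a^2=1$. *)

theory Defs
  imports "HOL-Algebra.Group" "HOL-Library.FSet"
begin

text \<open>Positions are identified only when they have the same game tree; they are not taken
  modulo any notion of equality of values.\<close>

datatype position = Position (left_opts: "position fset") (right_opts: "position fset")

lemma size_left_option: "x |\<in>| left_opts \<alpha> \<Longrightarrow> size x < size \<alpha>"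
proof (cases \<alpha>)
  case (Position A B)
  assume "x |\<in>| left_opts \<alpha>"
  then have "Suc (size x) \<le> (\<Sum>y\<in>fset A. Suc (size y))"
    using Position by (intro member_le_sum[of x "fset A" "\<lambda>y. Suc (size y)"]) auto
  then show ?thesis using Position by simp
qed

lemma size_right_option: "x |\<in>| right_opts \<alpha> \<Longrightarrow> size x < size \<alpha>"
proof (cases \<alpha>)
  case (Position A B)
  assume "x |\<in>| right_opts \<alpha>"
  then have "Suc (size x) \<le> (\<Sum>y\<in>fset B. Suc (size y))"
    using Position by (intro member_le_sum[of x "fset B" "\<lambda>y. Suc (size y)"]) auto
  then show ?thesis using Position by simp
qed

declare fimage_cong [fundef_cong]

instantiation position :: "{zero, plus}"
begin

definition zero_position :: position where
  "0 = Position {||} {||}"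

function plus_position :: "position \<Rightarrow> position \<Rightarrow> position" where
  "plus_position \<alpha> \<beta> = Position
     ((\<lambda>x. plus_position x \<beta>) |`| left_opts \<alpha> |\<union>| (\<lambda>y. plus_position \<alpha> y) |`| left_opts \<beta>)
     ((\<lambda>x. plus_position x \<beta>) |`| right_opts \<alpha> |\<union>| (\<lambda>y. plus_position \<alpha> y) |`| right_opts \<beta>)"
  by pat_completeness auto
termination
  by (relation "measure (\<lambda>(\<alpha>, \<beta>). size \<alpha> + size \<beta>)")
     (auto simp: size_left_option size_right_option)

instance ..

end

declare plus_position.simps [simp del]

definition star :: position where
  "star = Position {|0|} {|0|}"


datatype player = Left | Right

fun opponent :: "player \<Rightarrow> player" where
  "opponent Left = Right"
| "opponent Right = Left"

fun options :: "player \<Rightarrow> position \<Rightarrow> position fset" where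
  "options Left \<xi> = left_opts \<xi>"
| "options Right \<xi> = right_opts \<xi>"

lemma size_option: "x |\<in>| options p \<xi> \<Longrightarrow> size x < size \<xi>"
  by (cases p) (auto simp: size_left_option size_right_option)

text \<open>\<open>wins_first p \<xi>\<close>: player \<open>p\<close> wins the misere play of \<open>\<xi>\<close> when \<open>p\<close> moves first.
  Play is finite and never drawn, so \<open>p\<close> wins moving second iff the opponent does not win
  moving first.\<close>

function wins_first :: "player \<Rightarrow> position \<Rightarrow> bool" where
  "wins_first p \<xi> \<longleftrightarrow>
     options p \<xi> = {||} \<or> fBex (options p \<xi>) (\<lambda>x. \<not> wins_first (opponent p) x)"
  by pat_completeness auto
termination
  by (relation "measure (\<lambda>(p, \<xi>). size \<xi>)") (auto simp: size_option)

declare wins_first.simps [simp del]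

definition wins_second :: "player \<Rightarrow> position \<Rightarrow> bool" where
  "wins_second p \<xi> \<longleftrightarrow> \<not> wins_first (opponent p) \<xi>"

datatype outcome = \<L> | \<R> | \<N> | \<P>

definition misere_outcome :: "position \<Rightarrow> outcome" where
  "misere_outcome \<xi> =
     (if wins_first Left \<xi> \<and> wins_second Left \<xi> then \<L>
      else if wins_first Right \<xi> \<and> wins_second Right \<xi> then \<R>
      else if wins_first Left \<xi> \<and> wins_first Right \<xi> then \<N>
      else \<P>)"

lemma misere_outcome_iff:
  "misere_outcome \<xi> = \<L> \<longleftrightarrow> wins_first Left \<xi> \<and> wins_second Left \<xi>"
  "misere_outcome \<xi> = \<R> \<longleftrightarrow> wins_first Right \<xi> \<and> wins_second Right \<xi>"
  "misere_outcome \<xi> = \<N> \<longleftrightarrow> wins_first Left \<xi> \<and> wins_first Right \<xi>"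
  "misere_outcome \<xi> = \<P> \<longleftrightarrow> wins_second Left \<xi> \<and> wins_second Right \<xi>"
  by (auto simp: misere_outcome_def wins_second_def)


definition closed_positions :: "position set \<Rightarrow> bool" where
  "closed_positions \<Gamma> \<longleftrightarrow>
     (\<forall>\<alpha>\<in>\<Gamma>. \<forall>\<beta>\<in>\<Gamma>. \<alpha> + \<beta> \<in> \<Gamma>) \<and>
     (\<forall>\<alpha>\<in>\<Gamma>. fset (left_opts \<alpha>) \<subseteq> \<Gamma> \<and> fset (right_opts \<alpha>) \<subseteq> \<Gamma>)"

definition cl :: "position set \<Rightarrow> position set" where
  "cl \<Upsilon> = \<Inter>{\<Gamma>. closed_positions \<Gamma> \<and> \<Upsilon> \<subseteq> \<Gamma>}"

lemma closed_positions_cl: "closed_positions (cl \<Upsilon>)"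
  unfolding cl_def closed_positions_def by blast

lemma subset_cl: "\<Upsilon> \<subseteq> cl \<Upsilon>"
  unfolding cl_def by blast

lemma cl_least: "closed_positions \<Gamma> \<Longrightarrow> \<Upsilon> \<subseteq> \<Gamma> \<Longrightarrow> cl \<Upsilon> \<subseteq> \<Gamma>"
  unfolding cl_def by blast


definition misere_equiv :: "position set \<Rightarrow> (position \<times> position) set" where
  "misere_equiv \<Gamma> = {(\<alpha>, \<beta>). \<alpha> \<in> \<Gamma> \<and> \<beta> \<in> \<Gamma> \<and>
     (\<forall>\<gamma>\<in>\<Gamma>. misere_outcome (\<alpha> + \<gamma>) = misere_outcome (\<beta> + \<gamma>))}"

record 'a outcome_monoid = "'a monoid" +
  tetrapartition :: "'a \<Rightarrow> outcome"

definition misere_monoid :: "position set \<Rightarrow> position set outcome_monoid" where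
  "misere_monoid \<Gamma> =
     \<lparr>carrier = \<Gamma> // misere_equiv \<Gamma>,
      mult = (\<lambda>X Y. \<Union>\<alpha>\<in>X. \<Union>\<beta>\<in>Y. misere_equiv \<Gamma> `` {\<alpha> + \<beta>}),
      one = misere_equiv \<Gamma> `` {0},
      tetrapartition = (\<lambda>X. THE out. \<forall>\<xi>\<in>X. misere_outcome \<xi> = out)\<rparr>"

definition outcome_monoid_isomorphic ::
    "('a, 'c) outcome_monoid_scheme \<Rightarrow> ('b, 'd) outcome_monoid_scheme \<Rightarrow> bool" where
  "outcome_monoid_isomorphic M N \<longleftrightarrow>
     (\<exists>h\<in>iso M N. h \<one>\<^bsub>M\<^esub> = \<one>\<^bsub>N\<^esub> \<and>
        (\<forall>x\<in>carrier M. tetrapartition N (h x) = tetrapartition M x) \<and>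
        (\<forall>y\<in>carrier N. tetrapartition M (inv_into (carrier M) h y) = tetrapartition N y))"


text \<open>The operations of \<^const>\<open>misere_monoid\<close> are well defined on classes.\<close>

lemma options_plus:
  "left_opts (\<alpha> + \<beta>) = (\<lambda>x. x + \<beta>) |`| left_opts \<alpha> |\<union>| (\<lambda>y. \<alpha> + y) |`| left_opts \<beta>"
  "right_opts (\<alpha> + \<beta>) = (\<lambda>x. x + \<beta>) |`| right_opts \<alpha> |\<union>| (\<lambda>y. \<alpha> + y) |`| right_opts \<beta>"
  by (subst plus_position.simps, simp)+

lemma options_zero: "left_opts 0 = {||}" "right_opts 0 = {||}"
  by (simp_all add: zero_position_def)

lemma position_eqI:
  "left_opts \<alpha> = left_opts \<beta> \<Longrightarrow> right_opts \<alpha> = right_opts \<beta> \<Longrightarrow> \<alpha> = (\<beta> :: position)"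
  by (cases \<alpha>; cases \<beta>) simp

instance position :: comm_monoid_add
proof
  fix \<alpha> \<beta> \<gamma> :: position
  show "\<alpha> + \<beta> + \<gamma> = \<alpha> + (\<beta> + \<gamma>)"
  proof (induction "size \<alpha> + size \<beta> + size \<gamma>" arbitrary: \<alpha> \<beta> \<gamma> rule: less_induct)
    case less
    have "\<And>x. x |\<in>| left_opts \<alpha> \<or> x |\<in>| right_opts \<alpha> \<Longrightarrow> x + \<beta> + \<gamma> = x + (\<beta> + \<gamma>)"
      "\<And>x. x |\<in>| left_opts \<beta> \<or> x |\<in>| right_opts \<beta> \<Longrightarrow> \<alpha> + x + \<gamma> = \<alpha> + (x + \<gamma>)"
      "\<And>x. x |\<in>| left_opts \<gamma> \<or> x |\<in>| right_opts \<gamma> \<Longrightarrow> \<alpha> + \<beta> + x = \<alpha> + (\<beta> + x)"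
      by (rule less, use size_left_option size_right_option in force)+
    then show ?case
      by (intro position_eqI)
         (simp_all add: options_plus fimage_funion fset.map_comp comp_def funion_assoc
            cong: fimage_cong)
  qed
  show "\<alpha> + \<beta> = \<beta> + \<alpha>"
  proof (induction "size \<alpha> + size \<beta>" arbitrary: \<alpha> \<beta> rule: less_induct)
    case less
    have "x + \<beta> = \<beta> + x" if "x |\<in>| left_opts \<alpha> \<or> x |\<in>| right_opts \<alpha>" for x
      by (rule less) (use that size_left_option size_right_option in force)
    then have A: "(\<lambda>x. x + \<beta>) |`| left_opts \<alpha> = (\<lambda>x. \<beta> + x) |`| left_opts \<alpha>"
      "(\<lambda>x. x + \<beta>) |`| right_opts \<alpha> = (\<lambda>x. \<beta> + x) |`| right_opts \<alpha>"
      by (simp_all cong: fimage_cong)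
    have "\<alpha> + x = x + \<alpha>" if "x |\<in>| left_opts \<beta> \<or> x |\<in>| right_opts \<beta>" for x
      by (rule less) (use that size_left_option size_right_option in force)
    then have B: "(\<lambda>x. \<alpha> + x) |`| left_opts \<beta> = (\<lambda>x. x + \<alpha>) |`| left_opts \<beta>"
      "(\<lambda>x. \<alpha> + x) |`| right_opts \<beta> = (\<lambda>x. x + \<alpha>) |`| right_opts \<beta>"
      by (simp_all cong: fimage_cong)
    show ?case
      by (rule position_eqI; simp only: options_plus A B) (rule funion_commute)+
  qed
  show "0 + \<alpha> = \<alpha>"
  proof (induction "size \<alpha>" arbitrary: \<alpha> rule: less_induct)
    case less
    have "\<And>x. x |\<in>| left_opts \<alpha> \<or> x |\<in>| right_opts \<alpha> \<Longrightarrow> 0 + x = x"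
      by (rule less, use size_left_option size_right_option in force)
    then show ?case
      by (intro position_eqI)
         (simp_all add: options_plus options_zero cong: fimage_cong)
  qed
qed

lemma zero_in_closed:
  assumes "closed_positions \<Gamma>" "\<Gamma> \<noteq> {}"
  shows "0 \<in> \<Gamma>"
proof -
  have "\<alpha> \<in> \<Gamma> \<Longrightarrow> 0 \<in> \<Gamma>" for \<alpha>
  proof (induction "size \<alpha>" arbitrary: \<alpha> rule: less_induct)
    case less
    show ?case
    proof (cases "\<alpha> = 0")
      case False
      then obtain x where x: "x |\<in>| left_opts \<alpha> \<or> x |\<in>| right_opts \<alpha>"
        by (cases \<alpha>) (auto simp: zero_position_def)
      then have "x \<in> \<Gamma>" using assms less.prems by (auto simp: closed_positions_def)
      moreover have "size x < size \<alpha>" using x size_left_option size_right_option by blast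
      ultimately show ?thesis using less.hyps by blast
    qed (use less in simp)
  qed
  then show ?thesis using assms by blast
qed

lemma equiv_misere_equiv: "equiv \<Gamma> (misere_equiv \<Gamma>)"
  by (rule equivI) (auto simp: misere_equiv_def refl_on_def sym_on_def trans_on_def)

lemma misere_equiv_plus:
  assumes "closed_positions \<Gamma>" "(\<alpha>, \<alpha>') \<in> misere_equiv \<Gamma>" "(\<beta>, \<beta>') \<in> misere_equiv \<Gamma>"
  shows "(\<alpha> + \<beta>, \<alpha>' + \<beta>') \<in> misere_equiv \<Gamma>"
proof -
  have mem: "\<alpha> \<in> \<Gamma>" "\<alpha>' \<in> \<Gamma>" "\<beta> \<in> \<Gamma>" "\<beta>' \<in> \<Gamma>"
    using assms by (auto simp: misere_equiv_def)
  have "misere_outcome (\<alpha> + \<beta> + \<gamma>) = misere_outcome (\<alpha>' + \<beta>' + \<gamma>)" if "\<gamma> \<in> \<Gamma>" for \<gamma>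
  proof -
    have "misere_outcome (\<alpha> + (\<beta> + \<gamma>)) = misere_outcome (\<alpha>' + (\<beta> + \<gamma>))"
      using assms mem that by (auto simp: misere_equiv_def closed_positions_def)
    moreover have "misere_outcome (\<beta> + (\<alpha>' + \<gamma>)) = misere_outcome (\<beta>' + (\<alpha>' + \<gamma>))"
      using assms mem that by (auto simp: misere_equiv_def closed_positions_def)
    ultimately show ?thesis by (simp add: ac_simps)
  qed
  then show ?thesis
    using assms mem by (auto simp: misere_equiv_def closed_positions_def)
qed

lemma carrier_misere_monoid:
  "X \<in> carrier (misere_monoid \<Gamma>) \<longleftrightarrow> (\<exists>\<alpha>\<in>\<Gamma>. X = misere_equiv \<Gamma> `` {\<alpha>})"
  by (auto simp: misere_monoid_def quotient_def)

lemma mult_misere_monoid: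
  assumes "closed_positions \<Gamma>" "\<alpha> \<in> \<Gamma>" "\<beta> \<in> \<Gamma>"
  shows "misere_equiv \<Gamma> `` {\<alpha>} \<otimes>\<^bsub>misere_monoid \<Gamma>\<^esub> misere_equiv \<Gamma> `` {\<beta>}
       = misere_equiv \<Gamma> `` {\<alpha> + \<beta>}"
proof -
  have "misere_equiv \<Gamma> `` {\<alpha>' + \<beta>'} = misere_equiv \<Gamma> `` {\<alpha> + \<beta>}"
    if "(\<alpha>, \<alpha>') \<in> misere_equiv \<Gamma>" "(\<beta>, \<beta>') \<in> misere_equiv \<Gamma>" for \<alpha>' \<beta>'
    using equiv_class_eq[OF equiv_misere_equiv misere_equiv_plus[OF assms(1) that]] by simp
  moreover have "(\<alpha>, \<alpha>) \<in> misere_equiv \<Gamma>" "(\<beta>, \<beta>) \<in> misere_equiv \<Gamma>"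
    using assms by (auto simp: misere_equiv_def)
  ultimately have "(\<Union>\<alpha>'\<in>misere_equiv \<Gamma> `` {\<alpha>}. \<Union>\<beta>'\<in>misere_equiv \<Gamma> `` {\<beta>}.
      misere_equiv \<Gamma> `` {\<alpha>' + \<beta>'}) = misere_equiv \<Gamma> `` {\<alpha> + \<beta>}"
    by blast
  then show ?thesis
    by (simp add: misere_monoid_def)
qed

lemma tetrapartition_misere_monoid:
  assumes "closed_positions \<Gamma>" "\<alpha> \<in> \<Gamma>"
  shows "tetrapartition (misere_monoid \<Gamma>) (misere_equiv \<Gamma> `` {\<alpha>}) = misere_outcome \<alpha>"
proof -
  have "0 \<in> \<Gamma>" using assms zero_in_closed by blast
  then have "misere_outcome \<xi> = misere_outcome \<alpha>" if "(\<alpha>, \<xi>) \<in> misere_equiv \<Gamma>" for \<xi>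
    using that bspec[of \<Gamma> "\<lambda>\<gamma>. misere_outcome (\<alpha> + \<gamma>) = misere_outcome (\<xi> + \<gamma>)" 0]
    by (simp add: misere_equiv_def)
  moreover have "(\<alpha>, \<alpha>) \<in> misere_equiv \<Gamma>"
    using assms by (auto simp: misere_equiv_def)
  ultimately have "(THE out. \<forall>\<xi>\<in>misere_equiv \<Gamma> `` {\<alpha>}. misere_outcome \<xi> = out) = misere_outcome \<alpha>"
    by (intro the_equality) (blast, metis Image_singleton_iff)
  then show ?thesis
    by (simp add: misere_monoid_def)
qed

lemma comm_monoid_misere_monoid:
  assumes "closed_positions \<Gamma>" "\<Gamma> \<noteq> {}"
  shows "comm_monoid (misere_monoid \<Gamma>)"
proof -
  have plus: "\<alpha> + \<beta> \<in> \<Gamma>" if "\<alpha> \<in> \<Gamma>" "\<beta> \<in> \<Gamma>" for \<alpha> \<beta>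
    using assms that by (auto simp: closed_positions_def)
  have one: "\<one>\<^bsub>misere_monoid \<Gamma>\<^esub> = misere_equiv \<Gamma> `` {0}"
    by (simp add: misere_monoid_def)
  have zero: "0 \<in> \<Gamma>" using assms by (rule zero_in_closed)
  note [simp] = carrier_misere_monoid one mult_misere_monoid[OF assms(1)] plus zero
  show ?thesis
  proof (rule comm_monoidI)
    fix X Y
    assume "X \<in> carrier (misere_monoid \<Gamma>)" "Y \<in> carrier (misere_monoid \<Gamma>)"
    then obtain \<alpha> \<beta> where X: "\<alpha> \<in> \<Gamma>" "X = misere_equiv \<Gamma> `` {\<alpha>}"
      and Y: "\<beta> \<in> \<Gamma>" "Y = misere_equiv \<Gamma> `` {\<beta>}" by auto
    show "X \<otimes>\<^bsub>misere_monoid \<Gamma>\<^esub> Y \<in> carrier (misere_monoid \<Gamma>)"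
      using X Y plus[of \<alpha> \<beta>] by (simp del: plus) blast
    show "X \<otimes>\<^bsub>misere_monoid \<Gamma>\<^esub> Y = Y \<otimes>\<^bsub>misere_monoid \<Gamma>\<^esub> X"
      using X Y by (simp add: add.commute)
    show "\<one>\<^bsub>misere_monoid \<Gamma>\<^esub> \<otimes>\<^bsub>misere_monoid \<Gamma>\<^esub> X = X"
      using X by simp
    fix Z
    assume "Z \<in> carrier (misere_monoid \<Gamma>)"
    then obtain \<gamma> where Z: "\<gamma> \<in> \<Gamma>" "Z = misere_equiv \<Gamma> `` {\<gamma>}" by auto
    show "X \<otimes>\<^bsub>misere_monoid \<Gamma>\<^esub> Y \<otimes>\<^bsub>misere_monoid \<Gamma>\<^esub> Z
        = X \<otimes>\<^bsub>misere_monoid \<Gamma>\<^esub> (Y \<otimes>\<^bsub>misere_monoid \<Gamma>\<^esub> Z)"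
      using X Y Z by (simp add: add.assoc)
  next
    show "\<one>\<^bsub>misere_monoid \<Gamma>\<^esub> \<in> carrier (misere_monoid \<Gamma>)"
      using zero by (simp del: zero) blast
  qed
qed

end

theory Submission
  imports Defs
begin

text \<open>An isomorphism onto the two-element monoid \<open>{\<N>, \<P>}\<close>, with every element its own outcome,
  can only send a class to its outcome. So \<open>\<M>\<^bsub>\<Gamma>\<^esub>\<close> has this form iff the outcome of a sum is the
  sum modulo 2 of the outcomes (\<open>\<N>\<close> as 0, \<open>\<P>\<close> as 1), and \<open>\<P>\<close> occurs. If every move in \<open>\<Gamma>\<close>
  switches between \<open>\<N>\<close> and \<open>\<P>\<close>, then outcomes add in this way by induction, because in a
  \<open>\<P>\<close>-position neither player is without a move. Conversely, let \<open>\<pi>\<close> be a \<open>\<P>\<close>-position and \<open>x\<close>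
  an option of an \<open>\<N>\<close>-position \<open>\<xi>\<close>: since \<open>\<xi> + \<pi>\<close> has outcome \<open>\<P>\<close>, its option \<open>x + \<pi>\<close> has
  outcome \<open>\<N>\<close>, and so \<open>x\<close> has outcome \<open>\<P>\<close>.\<close>

subsection \<open>Options and outcomes\<close>

lemma all_player_iff: "(\<forall>p. Q p) \<longleftrightarrow> Q Left \<and> Q Right"
  by (metis player.exhaust)

lemma options_zero_player [simp]: "options p 0 = {||}"
  by (cases p) (simp_all add: options_zero)

lemma options_plus_player:
  "options p (\<alpha> + \<beta>) = (\<lambda>x. x + \<beta>) |`| options p \<alpha> |\<union>| (\<lambda>y. \<alpha> + y) |`| options p \<beta>"
  by (cases p) (simp_all add: options_plus)

lemma eq_zero_iff_options_empty: "\<xi> = 0 \<longleftrightarrow> (\<forall>p. options p \<xi> = {||})"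
  by (cases \<xi>) (simp add: all_player_iff zero_position_def)

lemma misere_outcome_\<N>_iff: "misere_outcome \<xi> = \<N> \<longleftrightarrow> (\<forall>p. wins_first p \<xi>)"
  by (simp add: misere_outcome_iff all_player_iff)

lemma misere_outcome_\<P>_iff: "misere_outcome \<xi> = \<P> \<longleftrightarrow> (\<forall>p. \<not> wins_first p \<xi>)"
  by (auto simp: misere_outcome_iff all_player_iff wins_second_def)

lemma options_nonempty_if_\<P>: "misere_outcome \<xi> = \<P> \<Longrightarrow> options p \<xi> \<noteq> {||}"
  using wins_first.simps[of p \<xi>] by (auto simp: misere_outcome_\<P>_iff)

lemma option_of_\<P>_not_\<P>:
  assumes "misere_outcome \<xi> = \<P>" "x |\<in>| options p \<xi>"
  shows "misere_outcome x \<noteq> \<P>"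
  using assms wins_first.simps[of p \<xi>] by (auto simp: misere_outcome_\<P>_iff)

lemma misere_outcome_\<N>I:
  assumes "\<And>p x. x |\<in>| options p \<xi> \<Longrightarrow> misere_outcome x = \<P>"
  shows "misere_outcome \<xi> = \<N>"
proof -
  have "wins_first p \<xi>" for p
    using assms by (subst wins_first.simps) (fastforce simp: misere_outcome_\<P>_iff)
  then show ?thesis by (simp add: misere_outcome_\<N>_iff)
qed

lemma misere_outcome_\<P>I:
  assumes "\<And>p. options p \<xi> \<noteq> {||}"
    and "\<And>p x. x |\<in>| options p \<xi> \<Longrightarrow> misere_outcome x = \<N>"
  shows "misere_outcome \<xi> = \<P>"
proof -
  have "\<not> wins_first p \<xi>" for p
    using assms by (subst wins_first.simps) (auto simp: misere_outcome_\<N>_iff)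
  then show ?thesis by (simp add: misere_outcome_\<P>_iff)
qed

lemma misere_outcome_zero: "misere_outcome 0 = \<N>"
  by (rule misere_outcome_\<N>I) simp

lemma plus_in_closed: "closed_positions \<Gamma> \<Longrightarrow> \<alpha> \<in> \<Gamma> \<Longrightarrow> \<beta> \<in> \<Gamma> \<Longrightarrow> \<alpha> + \<beta> \<in> \<Gamma>"
  by (simp add: closed_positions_def)

lemma option_in_closed: "closed_positions \<Gamma> \<Longrightarrow> \<xi> \<in> \<Gamma> \<Longrightarrow> x |\<in>| options p \<xi> \<Longrightarrow> x \<in> \<Gamma>"
  by (cases p) (auto simp: closed_positions_def)

lemma cl_subset_zero: "\<Upsilon> \<subseteq> {0} \<Longrightarrow> cl \<Upsilon> \<subseteq> {0}"
  by (rule cl_least) (auto simp: closed_positions_def options_zero)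

subsection \<open>Isomorphism of monoids with outcomes\<close>

lemma outcome_monoid_isomorphic_iff:
  "outcome_monoid_isomorphic M N \<longleftrightarrow>
     (\<exists>h\<in>iso M N. h \<one>\<^bsub>M\<^esub> = \<one>\<^bsub>N\<^esub> \<and> (\<forall>x\<in>carrier M. tetrapartition N (h x) = tetrapartition M x))"
proof -
  have "tetrapartition M (inv_into (carrier M) h y) = tetrapartition N y"
    if "h \<in> iso M N" "\<forall>x\<in>carrier M. tetrapartition N (h x) = tetrapartition M x" "y \<in> carrier N"
    for h y
    using that by (metis f_inv_into_f inv_into_into iso_iff)
  then show ?thesis unfolding outcome_monoid_isomorphic_def by blast
qed

lemma outcome_monoid_isomorphic_trans:
  assumes "outcome_monoid_isomorphic M N" "outcome_monoid_isomorphic N K"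
  shows "outcome_monoid_isomorphic M K"
proof -
  from assms(1) obtain h where h: "h \<in> iso M N" "h \<one>\<^bsub>M\<^esub> = \<one>\<^bsub>N\<^esub>"
      "\<forall>x\<in>carrier M. tetrapartition N (h x) = tetrapartition M x"
    unfolding outcome_monoid_isomorphic_iff by blast
  from assms(2) obtain k where k: "k \<in> iso N K" "k \<one>\<^bsub>N\<^esub> = \<one>\<^bsub>K\<^esub>"
      "\<forall>y\<in>carrier N. tetrapartition K (k y) = tetrapartition N y"
    unfolding outcome_monoid_isomorphic_iff by blast
  have "h x \<in> carrier N" if "x \<in> carrier M" for x
    using h(1) that by (auto simp: iso_iff)
  then show ?thesis
    unfolding outcome_monoid_isomorphic_iff
    using h k iso_set_trans[OF h(1) k(1)] by (intro bexI[of _ "k \<circ> h"]) auto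
qed

lemma outcome_monoid_isomorphic_sym:
  assumes "monoid M" "outcome_monoid_isomorphic M N"
  shows "outcome_monoid_isomorphic N M"
proof -
  interpret monoid M by fact
  from assms(2) obtain h where iso: "h \<in> iso M N" and one: "h \<one>\<^bsub>M\<^esub> = \<one>\<^bsub>N\<^esub>"
    and tetra: "\<forall>y\<in>carrier N. tetrapartition M (inv_into (carrier M) h y) = tetrapartition N y"
    unfolding outcome_monoid_isomorphic_def by blast
  let ?g = "inv_into (carrier M) h"
  have inj: "inj_on h (carrier M)" and surj: "h ` carrier M = carrier N"
    and hom: "\<And>x y. x \<in> carrier M \<Longrightarrow> y \<in> carrier M \<Longrightarrow> h (x \<otimes>\<^bsub>M\<^esub> y) = h x \<otimes>\<^bsub>N\<^esub> h y"
    using iso by (auto simp: iso_iff hom_def)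
  have closed: "?g y \<in> carrier M" and right_inverse: "h (?g y) = y" if "y \<in> carrier N" for y
    using that surj by (simp_all add: inv_into_into f_inv_into_f)
  have "?g \<in> hom N M"
  proof (rule homI)
    fix x y assume xy: "x \<in> carrier N" "y \<in> carrier N"
    show "?g (x \<otimes>\<^bsub>N\<^esub> y) = ?g x \<otimes>\<^bsub>M\<^esub> ?g y"
      by (rule inv_into_f_eq[OF inj]) (simp_all add: xy closed hom right_inverse)
  qed (rule closed)
  then have "?g \<in> iso N M"
    using iso by (simp add: iso_def bij_betw_inv_into)
  moreover have "?g \<one>\<^bsub>N\<^esub> = \<one>\<^bsub>M\<^esub>"
    using inv_into_f_f[OF inj one_closed] by (simp add: one)
  ultimately show ?thesis
    unfolding outcome_monoid_isomorphic_iff using tetra by blast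
qed

subsection \<open>Additive outcomes\<close>

definition parity_monoid :: "outcome outcome_monoid" where
  "parity_monoid = \<lparr>carrier = {\<N>, \<P>}, mult = (\<lambda>x y. if x = y then \<N> else \<P>), one = \<N>,
     tetrapartition = (\<lambda>x. x)\<rparr>"

lemma parity_monoid_simps [simp]:
  "carrier parity_monoid = {\<N>, \<P>}"
  "x \<otimes>\<^bsub>parity_monoid\<^esub> y = (if x = y then \<N> else \<P>)"
  "\<one>\<^bsub>parity_monoid\<^esub> = \<N>"
  "tetrapartition parity_monoid x = x"
  by (simp_all add: parity_monoid_def)

definition additive_outcomes :: "position set \<Rightarrow> bool" where
  "additive_outcomes \<Gamma> \<longleftrightarrow>
     (\<forall>\<alpha>\<in>\<Gamma>. misere_outcome \<alpha> \<in> {\<N>, \<P>}) \<and>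
     (\<forall>\<alpha>\<in>\<Gamma>. \<forall>\<beta>\<in>\<Gamma>.
        misere_outcome (\<alpha> + \<beta>) = misere_outcome \<alpha> \<otimes>\<^bsub>parity_monoid\<^esub> misere_outcome \<beta>)"

lemma carrier_misere_monoid_image:
  "carrier (misere_monoid \<Gamma>) = (\<lambda>\<alpha>. misere_equiv \<Gamma> `` {\<alpha>}) ` \<Gamma>"
  by (auto simp: carrier_misere_monoid)

lemma misere_equiv_if_same_outcome:
  assumes "additive_outcomes \<Gamma>" "\<alpha> \<in> \<Gamma>" "\<beta> \<in> \<Gamma>" "misere_outcome \<alpha> = misere_outcome \<beta>"
  shows "(\<alpha>, \<beta>) \<in> misere_equiv \<Gamma>"
  using assms by (simp add: misere_equiv_def additive_outcomes_def)

lemma misere_outcome_image_additive: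
  assumes "additive_outcomes \<Gamma>" "0 \<in> \<Gamma>" "\<pi> \<in> \<Gamma>" "misere_outcome \<pi> = \<P>"
  shows "misere_outcome ` \<Gamma> = {\<N>, \<P>}"
  using assms misere_outcome_zero by (force simp: additive_outcomes_def)

lemma isomorphic_parity_monoid_if_additive:
  assumes closed: "closed_positions \<Gamma>" and additive: "additive_outcomes \<Gamma>"
    and \<pi>: "\<pi> \<in> \<Gamma>" "misere_outcome \<pi> = \<P>"
  shows "outcome_monoid_isomorphic (misere_monoid \<Gamma>) parity_monoid"
proof -
  let ?M = "misere_monoid \<Gamma>" and ?cls = "\<lambda>\<alpha>. misere_equiv \<Gamma> `` {\<alpha>}"
  let ?h = "tetrapartition ?M"
  have zero: "0 \<in> \<Gamma>" using zero_in_closed[OF closed] \<pi>(1) by blast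
  have h_cls: "?h (?cls \<alpha>) = misere_outcome \<alpha>" if "\<alpha> \<in> \<Gamma>" for \<alpha>
    using closed that by (rule tetrapartition_misere_monoid)
  have "?h \<in> hom ?M parity_monoid"
  proof (rule homI)
    fix X assume "X \<in> carrier ?M"
    then show "?h X \<in> carrier parity_monoid"
      using additive by (auto simp: carrier_misere_monoid_image h_cls additive_outcomes_def)
  next
    fix X Y assume "X \<in> carrier ?M" "Y \<in> carrier ?M"
    then show "?h (X \<otimes>\<^bsub>?M\<^esub> Y) = ?h X \<otimes>\<^bsub>parity_monoid\<^esub> ?h Y"
      using additive
      by (auto simp: carrier_misere_monoid_image h_cls mult_misere_monoid[OF closed]
          plus_in_closed[OF closed] additive_outcomes_def)
  qed
  moreover have "inj_on ?h (carrier ?M)"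
  proof (rule inj_onI)
    fix X Y assume "X \<in> carrier ?M" "Y \<in> carrier ?M" and same: "?h X = ?h Y"
    then obtain \<alpha> \<beta> where \<alpha>: "\<alpha> \<in> \<Gamma>" "X = ?cls \<alpha>" and \<beta>: "\<beta> \<in> \<Gamma>" "Y = ?cls \<beta>"
      by (auto simp: carrier_misere_monoid_image)
    then have "misere_outcome \<alpha> = misere_outcome \<beta>" using same by (simp add: h_cls)
    then have "(\<alpha>, \<beta>) \<in> misere_equiv \<Gamma>"
      using additive \<alpha>(1) \<beta>(1) by (simp add: misere_equiv_if_same_outcome)
    then show "X = Y" using equiv_class_eq[OF equiv_misere_equiv] \<alpha>(2) \<beta>(2) by blast
  qed
  moreover have "?h ` carrier ?M = carrier parity_monoid"
    using misere_outcome_image_additive[OF additive zero \<pi>]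
    by (simp add: carrier_misere_monoid_image image_image h_cls)
  ultimately have "?h \<in> iso ?M parity_monoid"
    unfolding iso_iff by blast
  moreover have "?h \<one>\<^bsub>?M\<^esub> = \<one>\<^bsub>parity_monoid\<^esub>"
    using h_cls[OF zero] by (simp add: misere_monoid_def misere_outcome_zero)
  ultimately show ?thesis
    unfolding outcome_monoid_isomorphic_iff by (intro bexI[of _ ?h]) simp_all
qed

lemma additive_if_isomorphic_parity_monoid:
  assumes closed: "closed_positions \<Gamma>"
    and isomorphic: "outcome_monoid_isomorphic (misere_monoid \<Gamma>) parity_monoid"
  shows "additive_outcomes \<Gamma>" and "\<exists>\<pi>\<in>\<Gamma>. misere_outcome \<pi> = \<P>"
proof -
  let ?M = "misere_monoid \<Gamma>" and ?cls = "\<lambda>\<alpha>. misere_equiv \<Gamma> `` {\<alpha>}"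
  from isomorphic obtain h where iso: "h \<in> iso ?M parity_monoid"
    and "\<forall>X\<in>carrier ?M. h X = tetrapartition ?M X"
    by (auto simp: outcome_monoid_isomorphic_iff)
  then have h_cls: "h (?cls \<alpha>) = misere_outcome \<alpha>" if "\<alpha> \<in> \<Gamma>" for \<alpha>
    using that tetrapartition_misere_monoid[OF closed]
    by (simp add: carrier_misere_monoid_image)
  have "h ` carrier ?M = misere_outcome ` \<Gamma>"
    by (simp add: carrier_misere_monoid_image image_image h_cls)
  then have range: "misere_outcome ` \<Gamma> = {\<N>, \<P>}"
    using iso by (simp add: iso_iff)
  then show "\<exists>\<pi>\<in>\<Gamma>. misere_outcome \<pi> = \<P>" by (metis imageE insertI1 insert_commute)
  have "misere_outcome (\<alpha> + \<beta>) = misere_outcome \<alpha> \<otimes>\<^bsub>parity_monoid\<^esub> misere_outcome \<beta>"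
    if "\<alpha> \<in> \<Gamma>" "\<beta> \<in> \<Gamma>" for \<alpha> \<beta>
  proof -
    have "misere_outcome (\<alpha> + \<beta>) = h (?cls \<alpha> \<otimes>\<^bsub>?M\<^esub> ?cls \<beta>)"
      using that closed by (simp add: h_cls mult_misere_monoid plus_in_closed)
    also have "\<dots> = h (?cls \<alpha>) \<otimes>\<^bsub>parity_monoid\<^esub> h (?cls \<beta>)"
      using iso that by (intro hom_mult) (simp_all add: iso_iff carrier_misere_monoid_image)
    finally show ?thesis using that by (simp add: h_cls)
  qed
  then show "additive_outcomes \<Gamma>" using range by (auto simp: additive_outcomes_def)
qed

lemma isomorphic_parity_monoid_iff:
  assumes "closed_positions \<Gamma>"
  shows "outcome_monoid_isomorphic (misere_monoid \<Gamma>) parity_monoid \<longleftrightarrow>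
    additive_outcomes \<Gamma> \<and> (\<exists>\<pi>\<in>\<Gamma>. misere_outcome \<pi> = \<P>)"
  using isomorphic_parity_monoid_if_additive[OF assms] additive_if_isomorphic_parity_monoid[OF assms]
  by blast

subsection \<open>Alternating outcomes\<close>

definition alternating_outcomes :: "position set \<Rightarrow> bool" where
  "alternating_outcomes \<Gamma> \<longleftrightarrow>
     (\<forall>\<xi>\<in>\<Gamma>. misere_outcome \<xi> \<in> {\<N>, \<P>}) \<and>
     (\<forall>\<xi>\<in>\<Gamma>. misere_outcome \<xi> = \<N> \<longrightarrow>
        (\<forall>p x. x |\<in>| options p \<xi> \<longrightarrow> misere_outcome x = \<P>))"

lemma option_outcome_neq_if_alternating:
  assumes "alternating_outcomes \<Gamma>" "\<xi> \<in> \<Gamma>" "x |\<in>| options p \<xi>"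
  shows "misere_outcome x \<noteq> misere_outcome \<xi>"
  using assms option_of_\<P>_not_\<P>[OF _ assms(3)] by (auto simp: alternating_outcomes_def)

lemma misere_outcome_plus_alternating:
  assumes closed: "closed_positions \<Gamma>" and alternating: "alternating_outcomes \<Gamma>"
    and "\<alpha> \<in> \<Gamma>" "\<beta> \<in> \<Gamma>"
  shows "misere_outcome (\<alpha> + \<beta>) = misere_outcome \<alpha> \<otimes>\<^bsub>parity_monoid\<^esub> misere_outcome \<beta>"
  using assms(3,4)
proof (induction "size \<alpha> + size \<beta>" arbitrary: \<alpha> \<beta> rule: less_induct)
  case less
  have \<N>_or_\<P>: "misere_outcome \<xi> \<in> {\<N>, \<P>}" if "\<xi> \<in> \<Gamma>" for \<xi>
    using alternating that by (simp add: alternating_outcomes_def)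
  have outcome_move_in_summand:
    "misere_outcome (x + \<delta>) = (if misere_outcome \<gamma> = misere_outcome \<delta> then \<P> else \<N>)"
    if "\<gamma> \<in> \<Gamma>" "\<delta> \<in> \<Gamma>" "size \<gamma> + size \<delta> = size \<alpha> + size \<beta>" "x |\<in>| options p \<gamma>" for \<gamma> \<delta> x p
  proof -
    have "x \<in> \<Gamma>" using closed that(1,4) by (rule option_in_closed)
    then have "misere_outcome (x + \<delta>) = misere_outcome x \<otimes>\<^bsub>parity_monoid\<^esub> misere_outcome \<delta>"
      using size_option[OF that(4)] that(2,3) by (intro less.hyps) simp_all
    moreover have "misere_outcome x \<noteq> misere_outcome \<gamma>"
      using alternating that(1,4) by (rule option_outcome_neq_if_alternating)
    ultimately show ?thesis
      using \<N>_or_\<P>[OF \<open>x \<in> \<Gamma>\<close>] \<N>_or_\<P>[OF that(1)] \<N>_or_\<P>[OF that(2)] by auto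
  qed
  have outcome_move: "misere_outcome z = (if misere_outcome \<alpha> = misere_outcome \<beta> then \<P> else \<N>)"
    if "z |\<in>| options p (\<alpha> + \<beta>)" for p z
    using that outcome_move_in_summand[of \<alpha> \<beta> _ p] outcome_move_in_summand[of \<beta> \<alpha> _ p] less.prems
    by (auto simp: options_plus_player add.commute)
  show ?case
  proof (cases "misere_outcome \<alpha> = misere_outcome \<beta>")
    case True
    then show ?thesis using outcome_move by (simp add: misere_outcome_\<N>I)
  next
    case False
    then have "misere_outcome \<alpha> = \<P> \<or> misere_outcome \<beta> = \<P>"
      using \<N>_or_\<P>[OF less.prems(1)] \<N>_or_\<P>[OF less.prems(2)] by auto
    then have "options p (\<alpha> + \<beta>) \<noteq> {||}" for p
      using options_nonempty_if_\<P> by (auto simp: options_plus_player)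
    then show ?thesis using outcome_move False by (simp add: misere_outcome_\<P>I)
  qed
qed

lemma alternating_if_additive:
  assumes closed: "closed_positions \<Gamma>" and additive: "additive_outcomes \<Gamma>"
    and \<pi>: "\<pi> \<in> \<Gamma>" "misere_outcome \<pi> = \<P>"
  shows "alternating_outcomes \<Gamma>"
proof -
  have "misere_outcome x = \<P>"
    if "\<xi> \<in> \<Gamma>" "misere_outcome \<xi> = \<N>" "x |\<in>| options p \<xi>" for \<xi> x p
  proof -
    have "x \<in> \<Gamma>" using closed that(1,3) by (rule option_in_closed)
    have "misere_outcome (\<xi> + \<pi>) = \<P>"
      using additive that(1,2) \<pi> by (simp add: additive_outcomes_def)
    moreover have "x + \<pi> |\<in>| options p (\<xi> + \<pi>)"
      using that(3) by (simp add: options_plus_player)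
    ultimately have "misere_outcome (x + \<pi>) \<noteq> \<P>" by (rule option_of_\<P>_not_\<P>)
    then show ?thesis
      using additive \<open>x \<in> \<Gamma>\<close> \<pi> by (auto simp: additive_outcomes_def split: if_splits)
  qed
  then show ?thesis
    using additive unfolding alternating_outcomes_def additive_outcomes_def by blast
qed

lemma additive_iff_alternating:
  assumes "closed_positions \<Gamma>" "\<pi> \<in> \<Gamma>" "misere_outcome \<pi> = \<P>"
  shows "additive_outcomes \<Gamma> \<longleftrightarrow> alternating_outcomes \<Gamma>"
proof
  show "alternating_outcomes \<Gamma>" if "additive_outcomes \<Gamma>"
    using assms(1) that assms(2,3) by (rule alternating_if_additive)
  show "additive_outcomes \<Gamma>" if "alternating_outcomes \<Gamma>"
    using that misere_outcome_plus_alternating[OF assms(1) that]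
    unfolding additive_outcomes_def alternating_outcomes_def by blast
qed

lemma exists_\<P>_in_cl_iff:
  assumes "alternating_outcomes (cl \<Upsilon>)"
  shows "(\<exists>\<pi>\<in>cl \<Upsilon>. misere_outcome \<pi> = \<P>) \<longleftrightarrow> (\<exists>\<xi>\<in>\<Upsilon>. \<xi> \<noteq> 0)"
proof
  assume "\<exists>\<pi>\<in>cl \<Upsilon>. misere_outcome \<pi> = \<P>"
  then have "\<not> cl \<Upsilon> \<subseteq> {0}" using misere_outcome_zero by auto
  then show "\<exists>\<xi>\<in>\<Upsilon>. \<xi> \<noteq> 0" using cl_subset_zero by blast
next
  assume "\<exists>\<xi>\<in>\<Upsilon>. \<xi> \<noteq> 0"
  then obtain \<xi> p x where \<xi>: "\<xi> \<in> cl \<Upsilon>" and x: "x |\<in>| options p \<xi>"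
    using subset_cl by (fastforce simp: eq_zero_iff_options_empty)
  have "x \<in> cl \<Upsilon>" using closed_positions_cl \<xi> x by (rule option_in_closed)
  moreover have "misere_outcome \<xi> = \<P> \<or> misere_outcome x = \<P>"
    using assms \<xi> x by (auto simp: alternating_outcomes_def)
  ultimately show "\<exists>\<pi>\<in>cl \<Upsilon>. misere_outcome \<pi> = \<P>" using \<xi> by blast
qed

subsection \<open>Sums of stars\<close>

lemma options_star: "options p star = {|0|}"
  by (cases p) (simp_all add: star_def)

primrec stars :: "nat \<Rightarrow> position" where
  "stars 0 = 0"
| "stars (Suc n) = star + stars n"

lemma stars_add: "stars (m + n) = stars m + stars n"
  by (induction m) (simp_all add: add.assoc)

lemma options_stars_Suc: "options p (stars (Suc n)) = {|stars n|}"
proof (induction n)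
  case 0
  show ?case by (simp add: options_star)
next
  case (Suc n)
  have "options p (star + stars (Suc n)) =
      finsert (stars (Suc n)) ((+) star |`| options p (stars (Suc n)))"
    by (simp only: options_plus_player options_star) simp
  also have "\<dots> = {|stars (Suc n)|}" unfolding Suc by simp
  finally show ?case by (simp only: stars.simps(2))
qed

lemma closed_positions_stars: "closed_positions (range stars)"
proof -
  have "fset (options p (stars n)) \<subseteq> range stars" for p n
    by (cases n) (simp_all add: options_stars_Suc del: stars.simps(2))
  from this[of Left] this[of Right] show ?thesis
    by (auto simp: closed_positions_def stars_add[symmetric])
qed

lemma misere_outcome_stars: "misere_outcome (stars n) = (if even n then \<N> else \<P>)"
proof (induction n)
  case 0
  show ?case by (simp add: misere_outcome_zero)
next
  case (Suc n)
  then show ?case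
    using misere_outcome_\<N>I[of "stars (Suc n)"] misere_outcome_\<P>I[of "stars (Suc n)"]
    by (simp add: options_stars_Suc del: stars.simps(2))
qed

lemma cl_star: "cl {star} = range stars"
proof
  have "star = stars 1" by simp
  then show "cl {star} \<subseteq> range stars"
    using cl_least[OF closed_positions_stars] by blast
  have star_in_cl: "star \<in> cl {star}" using subset_cl by blast
  have "stars n \<in> cl {star}" for n
  proof (induction n)
    case 0
    show ?case using zero_in_closed[OF closed_positions_cl] star_in_cl by auto
  next
    case (Suc n)
    then show ?case using plus_in_closed[OF closed_positions_cl star_in_cl] by simp
  qed
  then show "range stars \<subseteq> cl {star}" by blast
qed

lemma misere_monoid_cl_star_isomorphic_parity_monoid:
  "outcome_monoid_isomorphic (misere_monoid (cl {star})) parity_monoid"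
proof (rule isomorphic_parity_monoid_if_additive)
  show "closed_positions (cl {star})" by (rule closed_positions_cl)
  show "additive_outcomes (cl {star})"
    by (auto simp: cl_star additive_outcomes_def misere_outcome_stars stars_add[symmetric])
  show "stars 1 \<in> cl {star}" by (simp only: cl_star rangeI)
  show "misere_outcome (stars 1) = \<P>" by (simp only: misere_outcome_stars) simp
qed

lemma isomorphic_misere_monoid_cl_star_iff:
  "outcome_monoid_isomorphic M (misere_monoid (cl {star})) \<longleftrightarrow>
   outcome_monoid_isomorphic M parity_monoid"
proof -
  have "cl {star} \<noteq> {}" by (simp add: cl_star)
  then have "monoid (misere_monoid (cl {star}))"
    by (intro comm_monoid.axioms(1) comm_monoid_misere_monoid closed_positions_cl)
  then show ?thesis
    using misere_monoid_cl_star_isomorphic_parity_monoid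
    by (meson outcome_monoid_isomorphic_sym outcome_monoid_isomorphic_trans)
qed

theorem theorem7p3p6:
  fixes \<Upsilon> :: "position set"
  shows "outcome_monoid_isomorphic (misere_monoid (cl \<Upsilon>)) (misere_monoid (cl {star})) \<longleftrightarrow>
    (\<exists>\<xi>\<in>\<Upsilon>. \<xi> \<noteq> 0) \<and>
    (\<forall>\<xi>\<in>cl \<Upsilon>. misere_outcome \<xi> \<in> {\<N>, \<P>}) \<and>
    (\<forall>\<xi>\<in>cl \<Upsilon>. misere_outcome \<xi> = \<N> \<longrightarrow>
       (\<forall>\<xi>L. \<xi>L |\<in>| left_opts \<xi> \<longrightarrow> misere_outcome \<xi>L = \<P>) \<and>
       (\<forall>\<xi>R. \<xi>R |\<in>| right_opts \<xi> \<longrightarrow> misere_outcome \<xi>R = \<P>))"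
    (is "?isomorphic \<longleftrightarrow> ?conditions")
proof -
  have "?isomorphic \<longleftrightarrow> outcome_monoid_isomorphic (misere_monoid (cl \<Upsilon>)) parity_monoid"
    by (rule isomorphic_misere_monoid_cl_star_iff)
  also have "\<dots> \<longleftrightarrow> additive_outcomes (cl \<Upsilon>) \<and> (\<exists>\<pi>\<in>cl \<Upsilon>. misere_outcome \<pi> = \<P>)"
    by (rule isomorphic_parity_monoid_iff[OF closed_positions_cl])
  also have "\<dots> \<longleftrightarrow> alternating_outcomes (cl \<Upsilon>) \<and> (\<exists>\<pi>\<in>cl \<Upsilon>. misere_outcome \<pi> = \<P>)"
    using additive_iff_alternating[OF closed_positions_cl] by blast
  also have "\<dots> \<longleftrightarrow> (\<exists>\<xi>\<in>\<Upsilon>. \<xi> \<noteq> 0) \<and> alternating_outcomes (cl \<Upsilon>)"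
    using exists_\<P>_in_cl_iff by blast
  also have "\<dots> \<longleftrightarrow> ?conditions"
    by (simp add: alternating_outcomes_def all_player_iff)
  finally show ?thesis .
qed

end
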